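(* Let $(P,\cdot,\circ)$ be a nonzero $2$-dimensional pre-Poisson algebra over $\mathbb C$. Then $P$ is isomorphic to one of the following algebras with basis $e_1,e_2$ (where $\alpha\in\mathbb C$). (a) Algebras with zero product $\cdot$: $P_{01}: e_1\circ e_1=e_1+e_2,\ e_2\circ e_1=e_2$; $P_{02}: e_1\circ e_1=e_1+e_2,\ e_1\circ e_2=e_2$; $P_{03}: e_1\circ e_1=e_2$; $P_{04}: e_2\circ e_1=e_1$; $P_{05}^{\alpha}: e_1\circ e_1=e_1,\ e_1\circ e_2=\alpha e_2$; $P_{06}^{\alpha}: e_1\circ e_1=e_1,\ e_1\circ e_2=\alpha e_2,\ e_2\circ e_1=e_2$; $P_{07}: e_1\circ e_1=e_1,\ e_2\circ e_2=e_2$; $P_{08}: e_1\circ e_1=e_1,\ e_1\circ e_2=2e_2,\ e_2\circ e_1=\frac12 e_1+e_2,\ e_2\circ e_2=e_2$. (b) Algebras with nonzero product $\cdot$: $P_{09}^{\alpha}: e_1\cdot e_1=e_2,\ e_1\circ e_1=\alpha e_2$; $P_{10}: e_1\cdot e_1=e_2,\ e_1\circ e_1=e_1,\ e_1\circ e_2=e_2,\ e_2\circ e_1=e_2$.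
   Context: A pre-Poisson algebra is a complex vector space with a (left) Zinbiel product $\cdot$, i.e. a bilinear product with $x\cdot(y\cdot z)=(y\cdot x+x\cdot y)\cdot z$, and a (left) pre-Lie product $\circ$, i.e. a bilinear product with $(x\circ y)\circ z-(y\circ x)\circ z=x\circ(y\circ z)-y\circ(x\circ z)$, such that $(x\circ y-y\circ x)\cdot z=x\circ(y\cdot z)-y\cdot(x\circ z)$ and $(x\cdot y+y\cdot x)\circ z=x\cdot(y\circ z)+y\cdot(x\circ z)$. It is nonzero if the two products are not both zero. Isomorphisms are linear bijections preserving both products. In multiplication tables, products of basis elements not listed are zero. *)

theory Defs
  imports "HOL-Analysis.Analysis"
begin

locale algebra_product = vector_space scale
  for scale :: "complex \<Rightarrow> 'a::ab_group_add \<Rightarrow> 'a" +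
  fixes mult :: "'a \<Rightarrow> 'a \<Rightarrow> 'a"
  assumes linear_right: "\<And>x. Vector_Spaces.linear scale scale (\<lambda>y. mult x y)"
    and linear_left: "\<And>y. Vector_Spaces.linear scale scale (\<lambda>x. mult x y)"

locale zinbiel_algebra = algebra_product scale dot
  for scale :: "complex \<Rightarrow> 'a::ab_group_add \<Rightarrow> 'a"
    and dot :: "'a \<Rightarrow> 'a \<Rightarrow> 'a" (infixl "\<odot>" 70) +
  assumes zinbiel: "\<And>x y z. x \<odot> (y \<odot> z) = (y \<odot> x + x \<odot> y) \<odot> z"

locale pre_lie_algebra = algebra_product scale circ
  for scale :: "complex \<Rightarrow> 'a::ab_group_add \<Rightarrow> 'a"
    and circ :: "'a \<Rightarrow> 'a \<Rightarrow> 'a" (infixl "\<diamondop>" 70) +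
  assumes pre_lie:
    "\<And>x y z. (x \<diamondop> y) \<diamondop> z - (y \<diamondop> x) \<diamondop> z = x \<diamondop> (y \<diamondop> z) - y \<diamondop> (x \<diamondop> z)"

locale pre_poisson_algebra =
  zinbiel_algebra scale dot + pre_lie_algebra scale circ
  for scale :: "complex \<Rightarrow> 'a::ab_group_add \<Rightarrow> 'a"
    and dot :: "'a \<Rightarrow> 'a \<Rightarrow> 'a" (infixl "\<odot>" 70)
    and circ :: "'a \<Rightarrow> 'a \<Rightarrow> 'a" (infixl "\<diamondop>" 70) +
  assumes commutator_dot:
      "\<And>x y z. (x \<diamondop> y - y \<diamondop> x) \<odot> z = x \<diamondop> (y \<odot> z) - y \<odot> (x \<diamondop> z)"
    and anticommutator_circ:
      "\<And>x y z. (x \<odot> y + y \<odot> x) \<diamondop> z = x \<odot> (y \<diamondop> z) + y \<odot> (x \<diamondop> z)"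

text \<open>A pair of products (dot, circ) on a common underlying vector space.\<close>

type_synonym 'a products = "('a \<Rightarrow> 'a \<Rightarrow> 'a) \<times> ('a \<Rightarrow> 'a \<Rightarrow> 'a)"

definition nonzero_products :: "'a::zero products \<Rightarrow> bool" where
  "nonzero_products P \<longleftrightarrow>
     \<not> ((\<forall>x y. fst P x y = 0) \<and> (\<forall>x y. snd P x y = 0))"

definition isomorphic_products ::
  "(complex \<Rightarrow> 'a::ab_group_add \<Rightarrow> 'a) \<Rightarrow> 'a products \<Rightarrow>
   (complex \<Rightarrow> 'b::ab_group_add \<Rightarrow> 'b) \<Rightarrow> 'b products \<Rightarrow> bool" where
  "isomorphic_products s P t Q \<longleftrightarrow>
     (\<exists>f. Vector_Spaces.linear s t f \<and> bij f \<and>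
          (\<forall>x y. f (fst P x y) = fst Q (f x) (f y)) \<and>
          (\<forall>x y. f (snd P x y) = snd Q (f x) (f y)))"

text \<open>
  The model algebras live on the coordinate space with standard basis \<open>e1\<close>, \<open>e2\<close>.
  The indices are the two elements of the numeral type 2, in which \<open>2 = 0\<close>.
  A multiplication table lists entries \<open>((i, j), v)\<close>, meaning that the product of the
  \<open>i\<close>-th and the \<open>j\<close>-th basis vector is \<open>v\<close>; unlisted products of basis vectors are
  zero, and \<open>table\<close> extends these values bilinearly.
\<close>

definition e1 :: "complex ^ 2" where
  "e1 = axis 1 1"

definition e2 :: "complex ^ 2" where
  "e2 = axis 2 1"

definition table :: "((2 \<times> 2) \<times> (complex ^ 2)) list \<Rightarrow>
    complex ^ 2 \<Rightarrow> complex ^ 2 \<Rightarrow> complex ^ 2" where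
  "table T x y = (\<Sum>i\<in>UNIV. \<Sum>j\<in>UNIV. (x $ i * y $ j) *s
     (case map_of T (i, j) of None \<Rightarrow> 0 | Some v \<Rightarrow> v))"

definition P01 :: "(complex ^ 2) products" where
  "P01 = (table [], table [((1, 1), e1 + e2), ((2, 1), e2)])"

definition P02 :: "(complex ^ 2) products" where
  "P02 = (table [], table [((1, 1), e1 + e2), ((1, 2), e2)])"

definition P03 :: "(complex ^ 2) products" where
  "P03 = (table [], table [((1, 1), e2)])"

definition P04 :: "(complex ^ 2) products" where
  "P04 = (table [], table [((2, 1), e1)])"

definition P05 :: "complex \<Rightarrow> (complex ^ 2) products" where
  "P05 \<alpha> = (table [], table [((1, 1), e1), ((1, 2), \<alpha> *s e2)])"

definition P06 :: "complex \<Rightarrow> (complex ^ 2) products" where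
  "P06 \<alpha> = (table [], table [((1, 1), e1), ((1, 2), \<alpha> *s e2), ((2, 1), e2)])"

definition P07 :: "(complex ^ 2) products" where
  "P07 = (table [], table [((1, 1), e1), ((2, 2), e2)])"

definition P08 :: "(complex ^ 2) products" where
  "P08 = (table [], table [((1, 1), e1), ((1, 2), 2 *s e2),
     ((2, 1), (1 / 2) *s e1 + e2), ((2, 2), e2)])"

definition P09 :: "complex \<Rightarrow> (complex ^ 2) products" where
  "P09 \<alpha> = (table [((1, 1), e2)], table [((1, 1), \<alpha> *s e2)])"

definition P10 :: "(complex ^ 2) products" where
  "P10 = (table [((1, 1), e2)],
     table [((1, 1), e1), ((1, 2), e2), ((2, 1), e2)])"

definition zero_dot_list :: "(complex ^ 2) products set" where
  "zero_dot_list = {P01, P02, P03, P04} \<union> range P05 \<union> range P06 \<union> {P07, P08}"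

definition nonzero_dot_list :: "(complex ^ 2) products set" where
  "nonzero_dot_list = range P09 \<union> {P10}"

end

theory Submission
  imports Defs
begin

text \<open>
  A noncommutative pre-Lie plane has a basis \<open>w, n\<close> with \<open>wn - nw = n\<close>. If \<open>n\<^sup>2\<close> is
  independent of \<open>n\<close>, then \<open>w\<close> can be chosen proportional to \<open>n\<^sup>2\<close> and the structure is
  forced; otherwise \<open>n\<^sup>2 = 0\<close> and \<open>nw\<close> is \<open>0\<close> or \<open>c n\<close>, where \<open>c\<close> is the \<open>w\<close>-coefficient
  of \<open>w\<^sup>2\<close>. A commutative pre-Lie plane is associative, so it either contains a nonzero
  idempotent or is spanned by some \<open>z, z\<^sup>2\<close> with \<open>z\<^sup>3 = 0\<close>. A nonzero Zinbiel product has a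
  basis \<open>z, z \<cdot> z\<close> in which all other products vanish, and compatibility then leaves
  only two free coefficients in the pre-Lie product.
\<close>

section \<open>Ordered bases of a plane\<close>

text \<open>Coefficients are kept explicit so that an identity between vectors becomes a pair of
  scalar equations through \<open>basis_pair_eq_iff\<close>. Only the scalar action enters, so one
  basis serves both products.\<close>

definition basis_pair :: "('k::field \<Rightarrow> 'b::ab_group_add \<Rightarrow> 'b) \<Rightarrow> 'b \<Rightarrow> 'b \<Rightarrow> bool" where
  "basis_pair sc u v \<longleftrightarrow> (\<forall>a b. sc a u + sc b v = 0 \<longrightarrow> a = 0 \<and> b = 0) \<and>
     (\<forall>x. \<exists>a b. x = sc a u + sc b v)"

context vector_space
begin

lemma basis_pair_coeffs:
  assumes "basis_pair scale u v"
  obtains a b where "x = scale a u + scale b v"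
  using assms unfolding basis_pair_def by blast

lemma basis_pair_eq_iff:
  assumes "basis_pair scale u v"
  shows "scale a u + scale b v = scale c u + scale d v \<longleftrightarrow> a = c \<and> b = d"
proof
  assume "scale a u + scale b v = scale c u + scale d v"
  then have "scale (a - c) u + scale (b - d) v = 0"
    by (simp add: scale_left_diff_distrib algebra_simps)
  then have "a - c = 0 \<and> b - d = 0"
    using assms unfolding basis_pair_def by blast
  then show "a = c \<and> b = d" by simp
qed simp

lemma basis_pair_nonzero:
  assumes "basis_pair scale u v"
  shows "v \<noteq> 0"
  using basis_pair_eq_iff[OF assms, of 0 1 0 0] by auto

lemma basis_pair_change:
  assumes uv: "basis_pair scale u v" and det: "p * s \<noteq> q * r"
  shows "basis_pair scale (scale p u + scale q v) (scale r u + scale s v)"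
proof -
  have comb: "scale a (scale p u + scale q v) + scale b (scale r u + scale s v) =
      scale (a * p + b * r) u + scale (a * q + b * s) v" for a b
    by (simp add: scale_right_distrib scale_left_distrib algebra_simps)
  have det0: "p * s - q * r \<noteq> 0" using det by simp
  show ?thesis unfolding basis_pair_def
  proof (intro conjI allI impI)
    fix a b
    assume "scale a (scale p u + scale q v) + scale b (scale r u + scale s v) = 0"
    then have "a * p + b * r = 0" "a * q + b * s = 0"
      using basis_pair_eq_iff[OF uv, of _ _ 0 0] unfolding comb by auto
    then have "a * (p * s - q * r) = 0" "b * (p * s - q * r) = 0"
      by algebra+
    then show "a = 0" "b = 0" using det0 by auto
  next
    fix x
    obtain a b where x: "x = scale a u + scale b v" by (rule basis_pair_coeffs[OF uv])
    \<comment> \<open>Cramer's rule: \<open>?D\<close> is the determinant of the change of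
      basis.\<close>
    let ?D = "p * s - q * r"
    have "((a * s - b * r) / ?D) * p + ((b * p - a * q) / ?D) * r = (a * ?D) / ?D"
      by (simp only: times_divide_eq_left add_divide_distrib[symmetric]) (simp add: algebra_simps)
    moreover have "((a * s - b * r) / ?D) * q + ((b * p - a * q) / ?D) * s = (b * ?D) / ?D"
      by (simp only: times_divide_eq_left add_divide_distrib[symmetric]) (simp add: algebra_simps)
    ultimately show "\<exists>a b. x = scale a (scale p u + scale q v) + scale b (scale r u + scale s v)"
      unfolding comb x using det0 by (metis nonzero_mult_div_cancel_right)
  qed
qed

text \<open>Exchange argument: \<open>v\<close> completes \<open>x\<close> to a basis if the
  \<open>u\<close>-coefficient of \<open>x\<close> is nonzero, and \<open>u\<close> does if the
  \<open>v\<close>-coefficient is.\<close>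

lemma basis_pair_extend:
  assumes uv: "basis_pair scale u v" and x: "x \<noteq> 0"
  obtains y where "basis_pair scale x y"
proof -
  obtain a b where ab: "x = scale a u + scale b v" by (rule basis_pair_coeffs[OF uv])
  then have "a \<noteq> 0 \<or> b \<noteq> 0" using x by auto
  then show thesis
    using that basis_pair_change[OF uv, of a 1 b 0] basis_pair_change[OF uv, of a 0 b 1] ab
    by auto
qed

lemma basis_pair_or_parallel:
  assumes uv: "basis_pair scale u v" and x: "x \<noteq> 0"
  obtains "basis_pair scale x y" | k where "y = scale k x"
proof -
  obtain z where xz: "basis_pair scale x z" by (rule basis_pair_extend[OF uv x])
  obtain a b where y: "y = scale a x + scale b z" by (rule basis_pair_coeffs[OF xz])
  show thesis
  proof (cases "b = 0")
    case True
    then show thesis using y that(2)[of a] by simp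
  next
    case False
    then show thesis using basis_pair_change[OF xz, of 1 b 0 a] y that(1) by simp
  qed
qed

lemma basis_pair_exists:
  assumes "local.dim UNIV = 2"
  obtains u v where "basis_pair scale u v"
proof -
  obtain B where B: "\<not> local.dependent B" "UNIV \<subseteq> local.span B" "card B = local.dim UNIV"
    using basis_exists[of UNIV] by metis
  then obtain u v where uv: "B = {u, v}" "u \<noteq> v"
    using assms by (metis card_2_iff)
  have "a = 0 \<and> b = 0" if ab: "scale a u + scale b v = 0" for a b
  proof -
    have "(if w = u then a else b) = 0" if "w \<in> B" for w
      using B(1) uv ab that independent_explicit_finite_subsets[of B, THEN iffD1, rule_format,
        of B "\<lambda>x. if x = u then a else b"] by auto
    from this[of u] this[of v] show ?thesis using uv by auto
  qed
  moreover have "\<exists>a b. x = scale a u + scale b v" for x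
  proof -
    have "x \<in> local.span {u, v}" using B(2) uv by auto
    then obtain a where "x - scale a u \<in> local.span {v}" using span_breakdown_eq by blast
    then obtain b where "x - scale a u = scale b v" using span_breakdown_eq[of _ v "{}"] by auto
    then show ?thesis by (metis add.commute diff_add_cancel)
  qed
  ultimately show thesis using that unfolding basis_pair_def by blast
qed

end

section \<open>Multiplication tables and structure constants\<close>

lemma table_expand:
  "table T x y =
     (x $ 1 * y $ 1) *s table T e1 e1 + (x $ 1 * y $ 2) *s table T e1 e2 +
     (x $ 2 * y $ 1) *s table T e2 e1 + (x $ 2 * y $ 2) *s table T e2 e2"
  by (simp add: table_def UNIV_2 e1_def e2_def axis_def)

context algebra_product
begin

lemma mult_simps:
  "mult (x + y) z = mult x z + mult y z"
  "mult x (y + z) = mult x y + mult x z"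
  "mult (scale a x) y = scale a (mult x y)"
  "mult x (scale a y) = scale a (mult x y)"
  using linear_left[of z] linear_right[of x] linear_left[of y]
  by (simp_all add: Vector_Spaces.linear_iff)

lemma mult_comb:
  "mult (scale a u + scale b v) (scale c u + scale d v) =
     scale (a * c) (mult u u) + scale (a * d) (mult u v) +
     scale (b * c) (mult v u) + scale (b * d) (mult v v)"
  by (simp add: mult_simps scale_right_distrib algebra_simps)

text \<open>The four pairs of coefficients are those of \<open>u\<^sup>2\<close>, \<open>uv\<close>, \<open>vu\<close> and \<open>v\<^sup>2\<close>.\<close>

definition has_constants where
  "has_constants u v a1 a2 b1 b2 c1 c2 d1 d2 \<longleftrightarrow> basis_pair scale u v \<and>
     mult u u = scale a1 u + scale a2 v \<and> mult u v = scale b1 u + scale b2 v \<and>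
     mult v u = scale c1 u + scale c2 v \<and> mult v v = scale d1 u + scale d2 v"

lemma has_constants_exists:
  assumes uv: "basis_pair scale u v"
  obtains a1 a2 b1 b2 c1 c2 d1 d2 where "has_constants u v a1 a2 b1 b2 c1 c2 d1 d2"
proof -
  obtain a1 a2 where 1: "mult u u = scale a1 u + scale a2 v" by (rule basis_pair_coeffs[OF uv])
  obtain b1 b2 where 2: "mult u v = scale b1 u + scale b2 v" by (rule basis_pair_coeffs[OF uv])
  obtain c1 c2 where 3: "mult v u = scale c1 u + scale c2 v" by (rule basis_pair_coeffs[OF uv])
  obtain d1 d2 where 4: "mult v v = scale d1 u + scale d2 v" by (rule basis_pair_coeffs[OF uv])
  show thesis by (rule that) (auto simp: has_constants_def uv 1 2 3 4)
qed

lemma mult_has_constants: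
  assumes "has_constants u v a1 a2 b1 b2 c1 c2 d1 d2"
  shows "mult (scale p u + scale q v) (scale r u + scale s v) =
     scale (p * r * a1 + p * s * b1 + q * r * c1 + q * s * d1) u +
     scale (p * r * a2 + p * s * b2 + q * r * c2 + q * s * d2) v"
  using assms unfolding mult_comb
  by (simp add: has_constants_def scale_right_distrib scale_left_distrib algebra_simps)

text \<open>Each pair of equations expands one product of new basis vectors in the old basis and
  compares it with the prescribed constants. Positional instantiations after \<open>OF rep\<close>
  list the coefficients as \<open>p s q r\<close>, their order in the determinant condition.\<close>

lemma has_constants_change:
  assumes rep: "has_constants u v a1 a2 b1 b2 c1 c2 d1 d2"
    and det: "p * s \<noteq> q * r"
    and "p * p * a1 + p * q * (b1 + c1) + q * q * d1 = A1 * p + A2 * r"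
    and "p * p * a2 + p * q * (b2 + c2) + q * q * d2 = A1 * q + A2 * s"
    and "p * r * a1 + p * s * b1 + q * r * c1 + q * s * d1 = B1 * p + B2 * r"
    and "p * r * a2 + p * s * b2 + q * r * c2 + q * s * d2 = B1 * q + B2 * s"
    and "p * r * a1 + p * s * c1 + q * r * b1 + q * s * d1 = C1 * p + C2 * r"
    and "p * r * a2 + p * s * c2 + q * r * b2 + q * s * d2 = C1 * q + C2 * s"
    and "r * r * a1 + r * s * (b1 + c1) + s * s * d1 = D1 * p + D2 * r"
    and "r * r * a2 + r * s * (b2 + c2) + s * s * d2 = D1 * q + D2 * s"
  shows "has_constants (scale p u + scale q v) (scale r u + scale s v) A1 A2 B1 B2 C1 C2 D1 D2"
proof -
  have uv: "basis_pair scale u v" using rep by (simp add: has_constants_def)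
  have comb: "scale a (scale p u + scale q v) + scale b (scale r u + scale s v) =
      scale (a * p + b * r) u + scale (a * q + b * s) v" for a b
    by (simp add: scale_right_distrib scale_left_distrib algebra_simps)
  show ?thesis
    unfolding has_constants_def mult_has_constants[OF rep] comb basis_pair_eq_iff[OF uv]
    using basis_pair_change[OF uv det] assms(3-) by (simp add: algebra_simps)
qed

lemma vanishes_if_basis_vanishes:
  assumes uv: "basis_pair scale u v"
    and "mult u u = 0" "mult u v = 0" "mult v u = 0" "mult v v = 0"
  shows "mult x y = 0"
proof -
  obtain a b where "x = scale a u + scale b v" by (rule basis_pair_coeffs[OF uv])
  moreover obtain c d where "y = scale c u + scale d v" by (rule basis_pair_coeffs[OF uv])
  ultimately show ?thesis using assms by (simp add: mult_comb)
qed

end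

section \<open>Isomorphisms onto table algebras\<close>

text \<open>\<open>F\<close> is the coordinate map sending \<open>e1\<close> to \<open>u\<close> and
  \<open>e2\<close> to \<open>v\<close>; by bilinearity it respects both products once it does so on
  the basis. The isomorphism asked for points towards the model, so it is
  \<open>inv F\<close>.\<close>

lemma isomorphic_products_tableI:
  fixes scale :: "complex \<Rightarrow> 'a::ab_group_add \<Rightarrow> 'a"
  assumes dot: "algebra_product scale dot" and circ: "algebra_product scale circ"
    and uv: "basis_pair scale u v"
    and F: "\<And>w. F w = scale (w $ 1) u + scale (w $ 2) v"
    and dots: "dot u u = F (table S e1 e1)" "dot u v = F (table S e1 e2)"
      "dot v u = F (table S e2 e1)" "dot v v = F (table S e2 e2)"
    and circs: "circ u u = F (table T e1 e1)" "circ u v = F (table T e1 e2)"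
      "circ v u = F (table T e2 e1)" "circ v v = F (table T e2 e2)"
  shows "isomorphic_products scale (dot, circ) (*s) (table S, table T)"
proof -
  interpret D: algebra_product scale dot by fact
  interpret C: algebra_product scale circ by fact
  have F_lin: "F (x + y) = F x + F y" "F (c *s x) = scale c (F x)" for x y c
    by (simp_all add: F D.scale_right_distrib D.scale_left_distrib)
  have bij: "bij F"
  proof (rule bijI)
    show "inj F"
      by (rule injI) (simp add: F D.basis_pair_eq_iff[OF uv] vec_eq_iff forall_2)
    show "surj F"
    proof -
      have "\<exists>w. x = F w" for x
      proof -
        obtain a b where "x = scale a u + scale b v" by (rule D.basis_pair_coeffs[OF uv])
        then have "x = F (vector [a, b])" by (simp add: F)
        then show ?thesis ..
      qed
      then show ?thesis by (auto simp: surj_def)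
    qed
  qed
  have linF: "Vector_Spaces.linear (*s) scale F"
    unfolding Vector_Spaces.linear_iff
    by (auto simp: F_lin vec.vector_space_axioms D.vector_space_axioms)
  have Finv: "F (inv F x) = x" "inv F (F w) = w" for x w
    using bij by (auto simp: bij_def surj_f_inv_f)
  have lin: "Vector_Spaces.linear scale (*s) (inv F)"
    unfolding Vector_Spaces.linear_iff
    by (auto simp: vec.vector_space_axioms D.vector_space_axioms)
       (metis F_lin Finv)+
  have mult: "dot (F w) (F z) = F (table S w z)" "circ (F w) (F z) = F (table T w z)" for w z
  proof -
    show "dot (F w) (F z) = F (table S w z)"
      unfolding table_expand[of S w z] F_lin dots[symmetric] unfolding F D.mult_comb ..
    show "circ (F w) (F z) = F (table T w z)"
      unfolding table_expand[of T w z] F_lin circs[symmetric] unfolding F C.mult_comb ..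
  qed
  have "inv F (dot x y) = table S (inv F x) (inv F y)"
    "inv F (circ x y) = table T (inv F x) (inv F y)" for x y
    by (metis mult Finv)+
  then show ?thesis
    unfolding isomorphic_products_def using lin bij_imp_bij_inv[OF bij] by auto
qed


lemma isomorphic_products_tables:
  fixes scale :: "complex \<Rightarrow> 'a::ab_group_add \<Rightarrow> 'a"
  assumes dot: "algebra_product scale dot" and circ: "algebra_product scale circ"
    and S: "algebra_product.has_constants scale dot u v (table S e1 e1 $ 1) (table S e1 e1 $ 2)
      (table S e1 e2 $ 1) (table S e1 e2 $ 2) (table S e2 e1 $ 1) (table S e2 e1 $ 2)
      (table S e2 e2 $ 1) (table S e2 e2 $ 2)"
    and T: "algebra_product.has_constants scale circ u v (table T e1 e1 $ 1) (table T e1 e1 $ 2)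
      (table T e1 e2 $ 1) (table T e1 e2 $ 2) (table T e2 e1 $ 1) (table T e2 e1 $ 2)
      (table T e2 e2 $ 1) (table T e2 e2 $ 2)"
  shows "isomorphic_products scale (dot, circ) (*s) (table S, table T)"
  using S T unfolding algebra_product.has_constants_def[OF dot]
    algebra_product.has_constants_def[OF circ]
  by (intro isomorphic_products_tableI[OF dot circ, of u v "\<lambda>w. scale (w $ 1) u + scale (w $ 2) v"])
     simp_all

lemma table_basis:
  "table T e1 e1 = (case map_of T (1, 1) of None \<Rightarrow> 0 | Some v \<Rightarrow> v)"
  "table T e1 e2 = (case map_of T (1, 2) of None \<Rightarrow> 0 | Some v \<Rightarrow> v)"
  "table T e2 e1 = (case map_of T (2, 1) of None \<Rightarrow> 0 | Some v \<Rightarrow> v)"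
  "table T e2 e2 = (case map_of T (2, 2) of None \<Rightarrow> 0 | Some v \<Rightarrow> v)"
  by (simp_all add: table_def UNIV_2 e1_def e2_def axis_def)

lemma e1_e2_components: "e1 $ 1 = 1" "e1 $ 2 = 0" "e2 $ 1 = 0" "e2 $ 2 = 1"
  by (simp_all add: e1_def e2_def axis_def)

section \<open>Normal forms for the pre-Lie product\<close>

context algebra_product
begin

text \<open>The disjuncts are the \<open>circ\<close> tables of \<open>P01\<close> to
  \<open>P08\<close>, in this order, so \<open>has_normal_formI(k)\<close> belongs to the
  \<open>k\<close>-th model. Since \<open>dot\<close> does not occur, pre-Lie planes can be
  classified on their own.\<close>

definition has_normal_form where
  "has_normal_form \<longleftrightarrow> (\<exists>u v.
     has_constants u v 1 1 0 0 0 1 0 0 \<or> has_constants u v 1 1 0 1 0 0 0 0 \<or>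
     has_constants u v 0 1 0 0 0 0 0 0 \<or> has_constants u v 0 0 0 0 1 0 0 0 \<or>
     (\<exists>\<alpha>. has_constants u v 1 0 0 \<alpha> 0 0 0 0) \<or> (\<exists>\<alpha>. has_constants u v 1 0 0 \<alpha> 0 1 0 0) \<or>
     has_constants u v 1 0 0 0 0 0 0 1 \<or> has_constants u v 1 0 0 2 (1 / 2) 1 0 1)"

lemma has_normal_formI:
  "has_constants u v 1 1 0 0 0 1 0 0 \<Longrightarrow> has_normal_form"
  "has_constants u v 1 1 0 1 0 0 0 0 \<Longrightarrow> has_normal_form"
  "has_constants u v 0 1 0 0 0 0 0 0 \<Longrightarrow> has_normal_form"
  "has_constants u v 0 0 0 0 1 0 0 0 \<Longrightarrow> has_normal_form"
  "has_constants u v 1 0 0 \<alpha> 0 0 0 0 \<Longrightarrow> has_normal_form"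
  "has_constants u v 1 0 0 \<alpha> 0 1 0 0 \<Longrightarrow> has_normal_form"
  "has_constants u v 1 0 0 0 0 0 0 1 \<Longrightarrow> has_normal_form"
  "has_constants u v 1 0 0 2 (1 / 2) 1 0 1 \<Longrightarrow> has_normal_form"
  unfolding has_normal_form_def by blast+

lemma normal_form_isomorphic:
  assumes "has_normal_form" and dot: "algebra_product scale dot" and zero: "\<And>x y. dot x y = 0"
  shows "\<exists>A \<in> zero_dot_list. isomorphic_products scale (dot, mult) (*s) A"
proof -
  have *: "isomorphic_products scale (dot, mult) (*s) (table [], table T)"
    if "has_constants u v (table T e1 e1 $ 1) (table T e1 e1 $ 2)
      (table T e1 e2 $ 1) (table T e1 e2 $ 2) (table T e2 e1 $ 1) (table T e2 e1 $ 2)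
      (table T e2 e2 $ 1) (table T e2 e2 $ 2)" for T u v
  proof (rule isomorphic_products_tables[OF dot algebra_product_axioms _ that])
    show "algebra_product.has_constants scale dot u v (table [] e1 e1 $ 1) (table [] e1 e1 $ 2)
      (table [] e1 e2 $ 1) (table [] e1 e2 $ 2) (table [] e2 e1 $ 1) (table [] e2 e1 $ 2)
      (table [] e2 e2 $ 1) (table [] e2 e2 $ 2)"
      using that
      by (simp add: algebra_product.has_constants_def[OF dot] has_constants_def zero table_basis)
  qed
  note eval = table_basis e1_e2_components
  have "isomorphic_products scale (dot, mult) (*s) P01" if "has_constants u v 1 1 0 0 0 1 0 0" for u v
    unfolding P01_def by (rule *[of u v]) (use that in \<open>simp add: eval\<close>)
  moreover have "isomorphic_products scale (dot, mult) (*s) P02"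
    if "has_constants u v 1 1 0 1 0 0 0 0" for u v
    unfolding P02_def by (rule *[of u v]) (use that in \<open>simp add: eval\<close>)
  moreover have "isomorphic_products scale (dot, mult) (*s) P03"
    if "has_constants u v 0 1 0 0 0 0 0 0" for u v
    unfolding P03_def by (rule *[of u v]) (use that in \<open>simp add: eval\<close>)
  moreover have "isomorphic_products scale (dot, mult) (*s) P04"
    if "has_constants u v 0 0 0 0 1 0 0 0" for u v
    unfolding P04_def by (rule *[of u v]) (use that in \<open>simp add: eval\<close>)
  moreover have "isomorphic_products scale (dot, mult) (*s) (P05 \<alpha>)"
    if "has_constants u v 1 0 0 \<alpha> 0 0 0 0" for u v \<alpha>
    unfolding P05_def by (rule *[of u v]) (use that in \<open>simp add: eval\<close>)
  moreover have "isomorphic_products scale (dot, mult) (*s) (P06 \<alpha>)"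
    if "has_constants u v 1 0 0 \<alpha> 0 1 0 0" for u v \<alpha>
    unfolding P06_def by (rule *[of u v]) (use that in \<open>simp add: eval\<close>)
  moreover have "isomorphic_products scale (dot, mult) (*s) P07"
    if "has_constants u v 1 0 0 0 0 0 0 1" for u v
    unfolding P07_def by (rule *[of u v]) (use that in \<open>simp add: eval\<close>)
  moreover have "isomorphic_products scale (dot, mult) (*s) P08"
    if "has_constants u v 1 0 0 2 (1 / 2) 1 0 1" for u v
    unfolding P08_def by (rule *[of u v]) (use that in \<open>simp add: eval\<close>)
  ultimately show ?thesis
    using assms(1) unfolding has_normal_form_def zero_dot_list_def by blast
qed

end

section \<open>Classification of pre-Lie planes\<close>

context pre_lie_algebra
begin

text \<open>The pre-Lie identity is skew in its first two arguments, so on a basis only the triples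
  \<open>u, v, u\<close> and \<open>u, v, v\<close> carry information; each yields two coordinate
  equations.\<close>

lemma pre_lie_constants:
  assumes rep: "has_constants u v a1 a2 b1 b2 c1 c2 d1 d2"
  shows "(b1 - c1) * a1 + (b2 - c2) * c1 = (c1 * a1 + c2 * b1) - (a1 * c1 + a2 * d1)"
    and "(b1 - c1) * a2 + (b2 - c2) * c2 = (c1 * a2 + c2 * b2) - (a1 * c2 + a2 * d2)"
    and "(b1 - c1) * b1 + (b2 - c2) * d1 = (d1 * a1 + d2 * b1) - (b1 * c1 + b2 * d1)"
    and "(b1 - c1) * b2 + (b2 - c2) * d2 = (d1 * a2 + d2 * b2) - (b1 * c2 + b2 * d2)"
proof -
  have uv: "basis_pair scale u v"
    and tab: "u \<diamondop> u = scale a1 u + scale a2 v" "u \<diamondop> v = scale b1 u + scale b2 v"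
      "v \<diamondop> u = scale c1 u + scale c2 v" "v \<diamondop> v = scale d1 u + scale d2 v"
    using rep by (auto simp: has_constants_def)
  have L: "(scale p u + scale q v) \<diamondop> u = scale (p * a1 + q * c1) u + scale (p * a2 + q * c2) v"
    "(scale p u + scale q v) \<diamondop> v = scale (p * b1 + q * d1) u + scale (p * b2 + q * d2) v"
    "u \<diamondop> (scale p u + scale q v) = scale (p * a1 + q * b1) u + scale (p * a2 + q * b2) v"
    "v \<diamondop> (scale p u + scale q v) = scale (p * c1 + q * d1) u + scale (p * c2 + q * d2) v" for p q
    using mult_has_constants[OF rep, of p q 1 0] mult_has_constants[OF rep, of p q 0 1]
      mult_has_constants[OF rep, of 1 0 p q] mult_has_constants[OF rep, of 0 1 p q] by simp_all
  have diff: "(scale a u + scale b v) - (scale c u + scale d v) =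
      scale (a - c) u + scale (b - d) v" for a b c d
    by (simp add: scale_left_diff_distrib algebra_simps)
  note eqs = pre_lie[of u v u] pre_lie[of u v v]
  note eqs' = eqs[unfolded tab L diff basis_pair_eq_iff[OF uv]]
  show "(b1 - c1) * a1 + (b2 - c2) * c1 = (c1 * a1 + c2 * b1) - (a1 * c1 + a2 * d1)"
    using eqs'(1) by (simp add: algebra_simps)
  show "(b1 - c1) * a2 + (b2 - c2) * c2 = (c1 * a2 + c2 * b2) - (a1 * c2 + a2 * d2)"
    using eqs'(1) by (simp add: algebra_simps)
  show "(b1 - c1) * b1 + (b2 - c2) * d1 = (d1 * a1 + d2 * b1) - (b1 * c1 + b2 * d1)"
    using eqs'(2) by (simp add: algebra_simps)
  show "(b1 - c1) * b2 + (b2 - c2) * d2 = (d1 * a2 + d2 * b2) - (b1 * c2 + b2 * d2)"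
    using eqs'(2) by (simp add: algebra_simps)
qed

text \<open>Here \<open>s\<close> is \<open>0\<close> or \<open>c\<close>. If \<open>c\<close> is
  nonzero, scaling \<open>w\<close> by \<open>1 / c\<close> and adding a multiple of
  \<open>n\<close> removes the \<open>n\<close>-part \<open>d\<close> of the square. This fails only
  for nonzero \<open>d\<close> at \<open>c = 1\<close> (with \<open>s = 0\<close>) or
  \<open>c = - 1\<close> (with \<open>s = c\<close>), giving \<open>P02\<close> and
  \<open>P01\<close>. The remaining case \<open>s = c = 0\<close> is \<open>P04\<close>.\<close>

lemma noncommutative_normal_form_nilpotent:
  assumes rep: "has_constants w n c d 0 (s + 1) 0 s 0 0" and s: "s * s = c * s"
  shows has_normal_form
proof (cases "s = 0")
  case s0: True
  show ?thesis
  proof (cases "c = 0")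
    case True
    show ?thesis
      by (rule has_normal_formI(4), rule has_constants_change[OF rep, of 0 "- d" 1 1])
        (use s0 True in simp_all)
  next
    case c: False
    show ?thesis
    proof (cases "c = 1 \<and> d \<noteq> 0")
      case True
      show ?thesis
        by (rule has_normal_formI(2), rule has_constants_change[OF rep, of 1 d 0 0])
          (use s0 True in simp_all)
    next
      case False
      \<comment> \<open>This value makes \<open>(1 / c) w + t n\<close> idempotent. If
        \<open>c = 1\<close>, then \<open>d = 0\<close>, and division by zero gives the right value
        \<open>t = 0\<close>.\<close>
      define t where "t = d / (c * (c - 1))"
      have t: "t * c * (c - 1) = d"
        using False c by (cases "c = 1") (simp_all add: t_def)
      show ?thesis
        by (rule has_normal_formI(5)[of _ _ "1 / c"],
            rule has_constants_change[OF rep, of "1 / c" 1 t 0])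
          (use s0 c in \<open>simp_all add: field_simps t[symmetric]\<close>)
    qed
  qed
next
  case False
  then have sc: "s = c" and c: "c \<noteq> 0" using s by auto
  show ?thesis
  proof (cases "c = - 1 \<and> d \<noteq> 0")
    case True
    show ?thesis
      by (rule has_normal_formI(1), rule has_constants_change[OF rep, of "- 1" d 0 0])
        (use sc True in simp_all)
  next
    case False
    \<comment> \<open>Again chosen for idempotency, now with \<open>s = c\<close>; for
      \<open>c = - 1\<close> the value is \<open>0\<close> by division by zero, matching
      \<open>d = 0\<close>.\<close>
    define t where "t = - d / (c * (c + 1))"
    have t: "d = - t * c * (c + 1)"
      using False c by (cases "c = - 1") (auto simp: t_def add_eq_0_iff2)
    show ?thesis
      by (rule has_normal_formI(6)[of _ _ "1 + 1 / c"],
          rule has_constants_change[OF rep, of "1 / c" 1 t 0])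
        (use sc c in \<open>simp_all add: field_simps t\<close>)
  qed
qed

text \<open>The structure equations force \<open>r = d = s = 0\<close> and \<open>c = 2\<close>, so
  \<open>p\<close> is the only parameter left, and a square root absorbs it.\<close>

lemma noncommutative_normal_form_independent_square:
  assumes rep: "has_constants w n c d r (s + 1) r s p 0" and p: "p \<noteq> 0"
  shows has_normal_form
proof -
  note eqs = pre_lie_constants[OF rep]
  have r: "r = 0" using eqs(1,4) by algebra
  then have d: "d = 0" using eqs(1) p by auto
  have "p * (c - s - 2) = 0" using eqs(3) r by algebra
  then have "c - s - 2 = 0" using p by simp
  then have c: "c = s + 2" by algebra
  have "s = 0" using eqs(2) r d c by (simp add: algebra_simps)
  note vals = this r d c
  \<comment> \<open>From \<open>4 p k^2 = - 1\<close> the vector \<open>w - 2 k n\<close> is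
    idempotent. So is \<open>w / 2\<close>, since \<open>w\<close> squares to \<open>2 w\<close>;
    these two form the basis of \<open>P08\<close>.\<close>
  define k where "k = csqrt (- 1 / (4 * p))"
  have "k\<^sup>2 = - 1 / (4 * p)" by (simp add: k_def)
  then have kp: "k * (k * (p * 4)) = - 1"
    using p by (simp add: power2_eq_square field_simps)
  then have k: "k \<noteq> 0" by auto
  show ?thesis
    by (rule has_normal_formI(8), rule has_constants_change[OF rep, of 1 0 "- 2 * k" "1 / 2"])
      (use vals k kp in \<open>simp_all add: algebra_simps\<close>)
qed

text \<open>Normalising the commutator to \<open>wn - nw = n\<close> makes left multiplication by \<open>n\<close>
  a commutator of left multiplications, hence traceless.\<close>

lemma noncommutative_normal_form:
  assumes uv: "basis_pair scale u v" and noncomm: "u \<diamondop> v \<noteq> v \<diamondop> u"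
  shows has_normal_form
proof -
  obtain k l where kl: "u \<diamondop> v - v \<diamondop> u = scale k u + scale l v"
    by (rule basis_pair_coeffs[OF uv])
  define n where "n = scale k u + scale l v"
  have comm: "(scale p u + scale q v) \<diamondop> (scale r u + scale s v) -
      (scale r u + scale s v) \<diamondop> (scale p u + scale q v) = scale (p * s - q * r) n" for p q r s
    unfolding n_def kl[symmetric] mult_comb
    by (simp add: scale_left_diff_distrib scale_right_diff_distrib algebra_simps)
  have "k \<noteq> 0 \<or> l \<noteq> 0" using noncomm kl by auto
  \<comment> \<open>The commutator of \<open>p u + q v\<close> with \<open>n\<close> is
    \<open>(p l - q k) n\<close>; one of these choices makes the factor \<open>1\<close>.\<close>
  then have "(1 / l) * l - 0 * k = 1 \<or> 0 * l - (- 1 / k) * k = 1" by auto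
  then obtain p q where pq: "p * l - q * k = 1" by blast
  define w where "w = scale p u + scale q v"
  have wn: "basis_pair scale w n"
    unfolding w_def n_def by (rule basis_pair_change[OF uv]) (use pq in auto)
  have comm_wn: "w \<diamondop> n - n \<diamondop> w = n"
    using comm[of p q k l] pq unfolding w_def[symmetric] n_def[symmetric] by simp
  \<comment> \<open>Stated for every \<open>w'\<close> with this commutator, because
    \<open>w\<close> is replaced by another vector below.\<close>
  have shape: "\<exists>c d r s p q. has_constants w' n c d r (s + 1) r s p q"
    if wn': "basis_pair scale w' n" and comm': "w' \<diamondop> n - n \<diamondop> w' = n" for w'
  proof -
    obtain a1 a2 b1 b2 c1 c2 d1 d2 where rep: "has_constants w' n a1 a2 b1 b2 c1 c2 d1 d2"
      by (rule has_constants_exists[OF wn'])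
    have "w' \<diamondop> n = scale 0 w' + scale 1 n + n \<diamondop> w'" using comm' by (simp add: algebra_simps)
    also have "\<dots> = scale c1 w' + scale (c2 + 1) n"
      using rep by (simp add: has_constants_def scale_left_distrib algebra_simps)
    finally have "b1 = c1" "b2 = c2 + 1"
      using rep basis_pair_eq_iff[OF wn'] by (auto simp: has_constants_def)
    then show ?thesis using rep by blast
  qed
  obtain c d r s p q where rep: "has_constants w n c d r (s + 1) r s p q"
    using shape[OF wn comm_wn] by blast
  note eqs = pre_lie_constants[OF rep]
  show ?thesis
  proof (cases "p = 0")
    case True
    have q: "q = - r" using eqs(1,4) by algebra
    have "r * r = 0" using eqs(3) q True by algebra
    then have r: "r = 0" by simp
    with q have q: "q = 0" by simp
    have "s * s = c * s" using eqs(2) r q by algebra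
    then show ?thesis
      by (rule noncommutative_normal_form_nilpotent[OF rep[unfolded r q True]])
  next
    case False
    \<comment> \<open>This makes the square of \<open>n\<close> equal to \<open>p w'\<close> and
      leaves the commutator unchanged, since \<open>n\<close> commutes with itself.\<close>
    define w' where "w' = scale 1 w + scale (q / p) n"
    have w'n: "basis_pair scale w' n"
      using basis_pair_change[OF wn, of 1 1 "q / p" 0] by (simp add: w'_def)
    have "w' \<diamondop> n - n \<diamondop> w' = n" using comm_wn by (simp add: w'_def mult_simps)
    then obtain c d r s p' q' where rep': "has_constants w' n c d r (s + 1) r s p' q'"
      using shape[OF w'n] by blast
    have "n \<diamondop> n = scale p w' + scale 0 n"
      using rep False by (simp add: w'_def has_constants_def scale_right_distrib)
    then have "scale p' w' + scale q' n = scale p w' + scale 0 n"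
      using rep' by (metis has_constants_def)
    then have "p' = p" "q' = 0"
      unfolding basis_pair_eq_iff[OF w'n] by simp_all
    then show ?thesis
      using rep' False noncommutative_normal_form_independent_square by blast
  qed
qed

text \<open>The algebra is \<open>C[y] / (y^2 - g)\<close> with unit \<open>e\<close>: dual numbers
  for \<open>g = 0\<close>, and otherwise split by the orthogonal idempotents
  \<open>(e + y / k) / 2\<close> and \<open>(e - y / k) / 2\<close> with
  \<open>k^2 = g\<close>.\<close>

lemma unital_normal_form:
  assumes rep: "has_constants e y 1 0 0 1 0 1 g 0"
  shows has_normal_form
proof (cases "g = 0")
  case True
  then show ?thesis using rep has_normal_formI(6)[of e y 1] by simp
next
  case False
  define k where "k = csqrt g"
  have k: "k \<noteq> 0" "g = k * k"
    using False power2_csqrt[of g] by (auto simp: k_def power2_eq_square)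
  show ?thesis
    by (rule has_normal_formI(7),
        rule has_constants_change[OF rep, of "1 / 2" "- 1 / (2 * k)" "1 / (2 * k)" "1 / 2"])
      (use k in \<open>simp_all add: field_simps\<close>)
qed

text \<open>Peirce decomposition: multiplication by \<open>e\<close> acts on the quotient by
  \<open>e\<close> as \<open>b2\<close>, which must be \<open>0\<close> or \<open>1\<close>. For
  \<open>0\<close>, the vector \<open>v - b1 e\<close> is annihilated by \<open>e\<close> and its
  square is \<open>d2\<close> times itself. For \<open>1\<close>, \<open>e\<close> is a
  unit.\<close>

lemma idempotent_normal_form:
  assumes comm: "\<And>x y. x \<diamondop> y = y \<diamondop> x" and ev: "basis_pair scale e v" and e: "e \<diamondop> e = e"
  shows has_normal_form
proof -
  obtain a1 a2 b1 b2 c1 c2 d1 d2 where rep': "has_constants e v a1 a2 b1 b2 c1 c2 d1 d2"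
    by (rule has_constants_exists[OF ev])
  have "scale a1 e + scale a2 v = scale 1 e + scale 0 v"
    using rep' e by (simp add: has_constants_def)
  moreover have "scale b1 e + scale b2 v = scale c1 e + scale c2 v"
    using rep' comm[of e v] by (metis has_constants_def)
  ultimately have rep: "has_constants e v 1 0 b1 b2 b1 b2 d1 d2"
    using rep' unfolding basis_pair_eq_iff[OF ev] by simp
  note eqs = pre_lie_constants[OF rep]
  have "b2 * (b2 - 1) = 0" using eqs(2) by algebra
  then consider "b2 = 0" | "b2 = 1" by auto
  then show ?thesis
  proof cases
    case 1
    have d1: "d1 = b1 * b1 - b1 * d2" using eqs(3) 1 by algebra
    show ?thesis
    proof (cases "d2 = 0")
      case True
      show ?thesis
        by (rule has_normal_formI(5)[of _ _ 0], rule has_constants_change[OF rep, of 1 1 0 "- b1"])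
          (use 1 d1 True in \<open>simp_all add: algebra_simps\<close>)
    next
      case False
      show ?thesis
        by (rule has_normal_formI(7),
            rule has_constants_change[OF rep, of 1 "1 / d2" 0 "- b1 / d2"])
          (use 1 False in \<open>simp_all add: d1 field_simps\<close>)
    qed
  next
    case 2
    have b1: "b1 = 0" using eqs(1) 2 by simp
    \<comment> \<open>Completing the square in \<open>v^2 = d1 e + d2 v\<close> gives the shift by
      \<open>- d2 / 2\<close>.\<close>
    show ?thesis
      by (rule unital_normal_form[where g = "d1 + d2 * d2 / 4"],
          rule has_constants_change[OF rep, of 1 1 0 "- d2 / 2"])
        (use 2 b1 in \<open>simp_all add: field_simps\<close>)
  qed
qed

lemma commutative_normal_form:
  assumes comm: "\<And>x y. x \<diamondop> y = y \<diamondop> x" and uv: "basis_pair scale u v"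
    and xy: "x \<diamondop> y \<noteq> 0"
  shows has_normal_form
proof -
  have idem: has_normal_form if "e \<noteq> 0" "e \<diamondop> e = e" for e
    using idempotent_normal_form[OF comm] basis_pair_extend[OF uv that(1)] that(2) by metis
  \<comment> \<open>Polarisation: a commutative product whose squares all vanish is zero in
    characteristic 0.\<close>
  have "\<exists>z. z \<diamondop> z \<noteq> 0"
  proof (rule ccontr)
    assume "\<nexists>z. z \<diamondop> z \<noteq> 0"
    then have sq: "z \<diamondop> z = 0" for z by blast
    have "(x + y) \<diamondop> (x + y) = x \<diamondop> x + y \<diamondop> y + (x \<diamondop> y + x \<diamondop> y)"
      by (simp add: mult_simps comm[of y x] add_ac)
    then have "scale 2 (x \<diamondop> y) = 0"
      using sq scale_left_distrib[of 1 1 "x \<diamondop> y"] by simp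
    then show False using xy by simp
  qed
  then obtain z where z: "z \<diamondop> z \<noteq> 0" by blast
  then have "z \<noteq> 0" using mult_simps(3)[of 0 z z] by auto
  from uv this show ?thesis
  proof (rule basis_pair_or_parallel[where y = "z \<diamondop> z"])
    fix k
    assume k: "z \<diamondop> z = scale k z"
    then have "k \<noteq> 0" using z by auto
    then show ?thesis
      using idem[of "scale (1 / k) z"] k \<open>z \<noteq> 0\<close> by (simp add: mult_simps)
  next
    assume basis: "basis_pair scale z (z \<diamondop> z)"
    define s where "s = z \<diamondop> z"
    have zs: "basis_pair scale z s" using basis by (simp add: s_def)
    obtain a1 a2 a b c1 c2 d1 d2 where rep': "has_constants z s a1 a2 a b c1 c2 d1 d2"
      by (rule has_constants_exists[OF zs])
    have "scale a1 z + scale a2 s = scale 0 z + scale 1 s"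
      using rep' by (simp add: has_constants_def s_def[symmetric])
    moreover have "scale a z + scale b s = scale c1 z + scale c2 s"
      using rep' comm[of z s] by (metis has_constants_def)
    ultimately have rep: "has_constants z s 0 1 a b a b d1 d2"
      using rep' unfolding basis_pair_eq_iff[OF zs] by simp
    note eqs = pre_lie_constants[OF rep]
    \<comment> \<open>These coefficients say \<open>s^2 = z (z s)\<close>, where
      \<open>z s = z^3 = a z + b s\<close>.\<close>
    have d: "d1 = a * b" "d2 = a + b * b" using eqs(1,2) by (simp_all add: algebra_simps)
    note mult = mult_has_constants[OF rep] and eq_iff = basis_pair_eq_iff[OF zs]
    consider "a = 0" "b = 0" | "a = 0" "b \<noteq> 0" | "a \<noteq> 0" by blast
    then show ?thesis
    proof cases
      case 1
      then show ?thesis using rep d has_normal_formI(3)[of z s] by simp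
    next
      case 2
      show ?thesis
      \<comment> \<open>Here \<open>s^2 = b^2 s\<close>, so scaling \<open>s\<close> gives an
        idempotent.\<close>
      proof (rule idem[of "scale 0 z + scale (1 / (b * b)) s"])
        show "scale 0 z + scale (1 / (b * b)) s \<noteq> 0"
          using basis_pair_nonzero[OF zs] 2 by simp
        show "(scale 0 z + scale (1 / (b * b)) s) \<diamondop> (scale 0 z + scale (1 / (b * b)) s) =
            scale 0 z + scale (1 / (b * b)) s"
          unfolding mult eq_iff using 2 d by (simp add: field_simps)
      qed
    next
      case 3
      show ?thesis
      \<comment> \<open>Since \<open>z^3 - b z^2 = a z\<close>, the vector
        \<open>(z^2 - b z) / a\<close> acts as the unit.\<close>
      proof (rule idem[of "scale (- b / a) z + scale (1 / a) s"])
        show "scale (- b / a) z + scale (1 / a) s \<noteq> 0"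
          using eq_iff[of _ _ 0 0] 3 by (metis add_0 divide_eq_0_iff one_neq_zero scale_zero_left)
        show "(scale (- b / a) z + scale (1 / a) s) \<diamondop> (scale (- b / a) z + scale (1 / a) s) =
            scale (- b / a) z + scale (1 / a) s"
          unfolding mult eq_iff using 3 d by (simp add: field_simps)
      qed
    qed
  qed
qed

lemma nonzero_normal_form:
  assumes uv: "basis_pair scale u v" and xy: "x \<diamondop> y \<noteq> 0"
  shows has_normal_form
proof (cases "u \<diamondop> v = v \<diamondop> u")
  case True
  have "x \<diamondop> y = y \<diamondop> x" for x y
  proof -
    obtain a b where x: "x = scale a u + scale b v" by (rule basis_pair_coeffs[OF uv])
    obtain c d where y: "y = scale c u + scale d v" by (rule basis_pair_coeffs[OF uv])
    show ?thesis unfolding x y mult_comb True by (simp add: algebra_simps)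
  qed
  then show ?thesis using commutative_normal_form uv xy by blast
qed (rule noncommutative_normal_form[OF uv])

end

section \<open>Zinbiel planes\<close>

context zinbiel_algebra
begin

text \<open>The Zinbiel identity at \<open>x, x, x\<close> reads
  \<open>k^2 x = 2 k^2 x\<close>.\<close>

lemma square_multiple_zero:
  assumes "x \<odot> x = scale k x"
  shows "x \<odot> x = 0"
proof -
  have "scale k (scale k x) = 0"
    using zinbiel[of x x x] by (simp add: assms mult_simps)
  then show ?thesis using assms by auto
qed

text \<open>If all squares vanished, the product would be anticommutative and the Zinbiel identity
  would kill every \<open>x (y z)\<close>. Multiplying \<open>u v = a u + b v\<close> by
  \<open>u\<close> and \<open>v\<close> on the left then gives \<open>b (u v) = 0\<close> and
  \<open>a (u v) = 0\<close>, hence \<open>u v = 0\<close>.\<close>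

lemma nonzero_square_exists:
  assumes uv: "basis_pair scale u v" and xy: "x \<odot> y \<noteq> 0"
  obtains z where "z \<odot> z \<noteq> 0"
proof (rule ccontr)
  assume "\<not> thesis"
  then have sq: "z \<odot> z = 0" for z using that by blast
  have anti: "y \<odot> x + x \<odot> y = 0" for x y
  proof -
    have "(x + y) \<odot> (x + y) = x \<odot> x + y \<odot> y + (y \<odot> x + x \<odot> y)"
      by (simp add: mult_simps add_ac)
    then show ?thesis by (simp add: sq)
  qed
  have triple: "x \<odot> (y \<odot> z) = 0" for x y z
    unfolding zinbiel anti using mult_simps(3)[of 0 0 z] by simp
  obtain a b where ab: "u \<odot> v = scale a u + scale b v" by (rule basis_pair_coeffs[OF uv])
  have vu: "v \<odot> u = - (u \<odot> v)" using anti[of v u] by (simp add: eq_neg_iff_add_eq_0)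
  have "w \<odot> (scale a u + scale b v) = 0" for w using triple[of w u v] by (simp only: ab)
  from this[of u] this[of v] have "scale b (u \<odot> v) = 0" "scale a (u \<odot> v) = 0"
    by (simp_all add: mult_simps sq vu scale_minus_right)
  then have "u \<odot> v = 0" using ab by auto
  then show False using vanishes_if_basis_vanishes[OF uv sq _ _ sq] vu xy by simp
qed

text \<open>With \<open>s = z^2\<close>, the Zinbiel identity expresses \<open>z s\<close> and
  \<open>s s\<close> through the coefficients \<open>a, b\<close> of \<open>s z\<close>; the triple
  \<open>z, z, s\<close> then forces \<open>a = b = 0\<close>.\<close>

lemma nonzero_normal_form:
  assumes uv: "basis_pair scale u v" and xy: "x \<odot> y \<noteq> 0"
  obtains z s where "has_constants z s 0 1 0 0 0 0 0 0"
proof -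
  obtain z where z: "z \<odot> z \<noteq> 0" by (rule nonzero_square_exists[OF uv xy])
  then have "z \<noteq> 0" using mult_simps(3)[of 0 z z] by auto
  define s where "s = z \<odot> z"
  have zs: "basis_pair scale z s"
    using basis_pair_or_parallel[OF uv \<open>z \<noteq> 0\<close>, of s] square_multiple_zero z
    unfolding s_def by metis
  obtain a1 a2 b1 b2 a b d1 d2 where rep': "has_constants z s a1 a2 b1 b2 a b d1 d2"
    by (rule has_constants_exists[OF zs])
  note eq_iff = basis_pair_eq_iff[OF zs]
  have "scale a1 z + scale a2 s = scale 0 z + scale 1 s"
    using rep' by (simp add: has_constants_def s_def[symmetric])
  then have rep: "has_constants z s 0 1 b1 b2 a b d1 d2"
    using rep' unfolding eq_iff by simp
  note mult = mult_has_constants[OF rep]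
  have tab: "z \<odot> z = scale 0 z + scale 1 s" "z \<odot> s = scale b1 z + scale b2 s"
    "s \<odot> z = scale a z + scale b s" "s \<odot> s = scale d1 z + scale d2 s"
    using rep by (simp_all add: has_constants_def)
  have L: "(scale p z + scale q s) \<odot> z = scale (q * a) z + scale (p + q * b) s"
    "(scale p z + scale q s) \<odot> s = scale (p * b1 + q * d1) z + scale (p * b2 + q * d2) s"
    "z \<odot> (scale p z + scale q s) = scale (q * b1) z + scale (p + q * b2) s"
    "s \<odot> (scale p z + scale q s) = scale (p * a + q * d1) z + scale (p * b + q * d2) s" for p q
    using mult[of p q 1 0] mult[of p q 0 1] mult[of 1 0 p q] mult[of 0 1 p q] by simp_all
  have add: "(scale p z + scale q s) + (scale p' z + scale q' s) =
      scale (p + p') z + scale (q + q') s" for p q p' q'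
    by (simp add: scale_left_distrib algebra_simps)
  have b: "b1 = 2 * a" "b2 = 2 * b"
    using zinbiel[of z z z, unfolded tab add L, unfolded eq_iff] by simp_all
  have d: "d1 = 3 * (a * b)" "d2 = 3 * (a + b * b)"
    using zinbiel[of s z z, unfolded tab add L, unfolded eq_iff] b by simp_all
  have "2 * b * b1 = 2 * d1" "b1 + b2 * b2 = 2 * d2"
    using zinbiel[of z z s, unfolded tab add L, unfolded eq_iff] b by simp_all
  then have ab: "a * b = 0" "2 * a = - (b * b)"
    unfolding b d by algebra+
  \<comment> \<open>Multiplying \<open>2 a = - b^2\<close> by \<open>b\<close> and using
    \<open>a b = 0\<close>.\<close>
  then have "b * b * b = 0" by algebra
  then have "b = 0" by simp
  with ab have "a = 0" by simp
  show thesis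
    using that[of z s] rep b d \<open>a = 0\<close> \<open>b = 0\<close> by simp
qed

end

section \<open>Compatibility of the two products and the final classification\<close>

theorem theorem65:
  fixes scale :: "complex \<Rightarrow> 'a::ab_group_add \<Rightarrow> 'a"
    and dot circ :: "'a \<Rightarrow> 'a \<Rightarrow> 'a"
  assumes "pre_poisson_algebra scale dot circ"
    and "vector_space.dim scale (UNIV :: 'a set) = 2"
    and "nonzero_products (dot, circ)"
  shows "\<exists>A \<in> zero_dot_list \<union> nonzero_dot_list.
           isomorphic_products scale (dot, circ) (*s) A"
proof -
  note P = assms(1)
  interpret D: zinbiel_algebra scale dot by (rule pre_poisson_algebra.axioms(1)[OF P])
  interpret C: pre_lie_algebra scale circ by (rule pre_poisson_algebra.axioms(2)[OF P])
  obtain u v where uv: "basis_pair scale u v"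
    by (rule D.basis_pair_exists[OF assms(2)])
  show ?thesis
  proof (cases "\<forall>x y. dot x y = 0")
    case True
    then obtain x y where "circ x y \<noteq> 0"
      using assms(3) by (auto simp: nonzero_products_def)
    then have "C.has_normal_form" by (rule C.nonzero_normal_form[OF uv])
    then show ?thesis
      using C.normal_form_isomorphic[OF _ D.algebra_product_axioms] True by blast
  next
    case False
    then obtain x y where xy: "dot x y \<noteq> 0" by blast
    obtain z s where D: "D.has_constants z s 0 1 0 0 0 0 0 0"
      by (rule D.nonzero_normal_form[OF uv xy])
    then have zs: "basis_pair scale z s" by (simp add: D.has_constants_def)
    obtain a1 a2 b1 b2 c1 c2 d1 d2 where C: "C.has_constants z s a1 a2 b1 b2 c1 c2 d1 d2"
      by (rule C.has_constants_exists[OF zs])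
    \<comment> \<open>Zero coordinates are written out so that \<open>eq_iff\<close> can compare
      coefficients after rewriting.\<close>
    have tab: "dot z z = scale 0 z + scale 1 s" "dot z s = scale 0 z + scale 0 s"
      "dot s z = scale 0 z + scale 0 s" "dot s s = scale 0 z + scale 0 s"
      "circ z z = scale a1 z + scale a2 s" "circ z s = scale b1 z + scale b2 s"
      "circ s z = scale c1 z + scale c2 s" "circ s s = scale d1 z + scale d2 s"
      using C D by (simp_all add: C.has_constants_def D.has_constants_def)
    have LD: "dot z (scale p z + scale q s) = scale 0 z + scale p s" for p q
      using D.mult_has_constants[OF D, of 1 0 p q] by simp
    have LC: "circ (scale p z + scale q s) z = scale (p * a1 + q * c1) z + scale (p * a2 + q * c2) s"
      "circ (scale p z + scale q s) s = scale (p * b1 + q * d1) z + scale (p * b2 + q * d2) s"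
      "circ z (scale p z + scale q s) = scale (p * a1 + q * b1) z + scale (p * a2 + q * b2) s" for p q
      using C.mult_has_constants[OF C, of p q 1 0] C.mult_has_constants[OF C, of p q 0 1]
        C.mult_has_constants[OF C, of 1 0 p q] by simp_all
    have add: "(scale p z + scale q s) + (scale p' z + scale q' s) =
        scale (p + p') z + scale (q + q') s" for p q p' q'
      by (simp add: D.scale_left_distrib algebra_simps)
    have diff: "(scale p z + scale q s) - (scale p' z + scale q' s) =
        scale (p - p') z + scale (q - q') s" for p q p' q'
      by (simp add: D.scale_left_diff_distrib algebra_simps)
    note eq_iff = D.basis_pair_eq_iff[OF zs]
    have zero: "dot (scale 0 z + scale 0 s) z = scale 0 z + scale 0 s"
      using D.mult_has_constants[OF D, of 0 0 1 0] by simp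
    \<comment> \<open>The left side vanishes for equal arguments, leaving
      \<open>circ z s = dot z (circ z z)\<close>, which is \<open>a1 s\<close>.\<close>
    have b: "b1 = 0" "b2 = a1"
      using pre_poisson_algebra.commutator_dot[OF P, of z z z, unfolded diff tab LD LC,
          unfolded diff right_minus_eq
          cancel_comm_monoid_add_class.diff_cancel, unfolded zero eq_iff] by simp_all
    \<comment> \<open>Up to the factor 2, this instance is
      \<open>circ s z = dot z (circ z z)\<close>; the next one is
      \<open>circ s s = dot z (circ z s)\<close>, which vanishes because
      \<open>b1 = 0\<close>.\<close>
    have c: "c1 = 0" "c2 = a1"
      using pre_poisson_algebra.anticommutator_circ[OF P, of z z z, unfolded tab add LD LC,
          unfolded add eq_iff] by simp_all
    have d: "d1 = 0" "d2 = 0"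
      using pre_poisson_algebra.anticommutator_circ[OF P, of z z s, unfolded tab add LD LC,
          unfolded add eq_iff] b by simp_all
    have C': "C.has_constants z s a1 a2 0 a1 0 a1 0 0"
      using C unfolding b c d .
    note iso = isomorphic_products_tables[OF D.algebra_product_axioms C.algebra_product_axioms]
    show ?thesis
    proof (cases "a1 = 0")
      case True
      have "isomorphic_products scale (dot, circ) (*s) (P09 a2)"
        unfolding P09_def
        by (rule iso[of z s]) (use D C' True in \<open>simp_all add: table_basis e1_e2_components\<close>)
      then show ?thesis by (auto simp: nonzero_dot_list_def)
    next
      case False
      \<comment> \<open>The square of \<open>z / a1 + t s\<close> under \<open>circ\<close> has
        \<open>s\<close>-coefficient \<open>a2 / a1^2 + 2 t\<close>, so this \<open>t\<close> makes
        the vector idempotent. Its square under \<open>dot\<close> is \<open>s / a1^2\<close>, which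
        dictates \<open>?y\<close>.\<close>
      define t where "t = - a2 / (a1 * a1)"
      let ?x = "scale (1 / a1) z + scale t s" and ?y = "scale 0 z + scale (1 / (a1 * a1)) s"
      have "D.has_constants ?x ?y 0 1 0 0 0 0 0 0"
        by (rule D.has_constants_change[OF D]) (use False in simp_all)
      moreover have "C.has_constants ?x ?y 1 0 0 1 0 1 0 0"
        by (rule C.has_constants_change[OF C']) (use False in \<open>simp_all add: t_def field_simps\<close>)
      ultimately have "isomorphic_products scale (dot, circ) (*s) P10"
        unfolding P10_def
        by (intro iso[of ?x ?y]) (simp_all add: table_basis e1_e2_components)
      then show ?thesis by (auto simp: nonzero_dot_list_def)
    qed
  qed
qed

end
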